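(* Let $E=\{a,b,c,d,e,f,g,h,i,j,k\}$. Let $M_1$ be the rank-$3$ matroid on $E$ whose bases are the $3$-element subsets $B\subseteq E$ with $|B\cap F|\le 2$ for each of the fifteen sets $$\{a,b,k\},\{b,c,e\},\{c,d,i\},\{a,d,f\},\{b,d,h\},\{a,c,j\},\{e,f,i\},\{f,g,c\},\{g,h,j\},\{h,e,a\},\{e,g,d\},\{f,h,k\},\{i,j,b\},\{j,k,e\},\{k,i,g\}.$$ Let $M_2$ be the rank-$3$ matroid on $E$ whose bases are the $3$-element subsets $B\subseteq E$ with $|B\cap\{a,b,c,d\}|\le 1$, $|B\cap\{e,f,g,h\}|\le 1$, $|B\cap\{e,f,g,h,i,j,k\}|\le 2$ and $|B\cap\{i,j\}|\le 1$. Then the pair $(M_1,M_2)$ is a counterexample to Lucas's conjecture: $\mathcal{B}(M_2)\subseteq\mathcal{B}(M_1)$, $M_1$ covers $M_2$ in the weak-map order (there is no matroid $M_3$ on $E$ with $\mathcal{B}(M_2)\subsetneq\mathcal{B}(M_3)\subsetneq\mathcal{B}(M_1)$), the dimension of the base polytope of $M_2$ is smaller than that of $M_1$, and yet the base polytope of $M_2$ is not a facet of the base polytope of $M_1$.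
   Context: $\mathcal{B}(N)$ denotes the set of bases of a matroid $N$; the weak-map order on matroids of the same rank on $E$ is $N\succeq N'$ iff $\mathcal{B}(N')\subseteq\mathcal{B}(N)$. The base polytope is $B(N)=\mathrm{conv}\{\chi_B:B\in\mathcal{B}(N)\}$, of dimension $|E|$ minus the number of connected components of $N$. Lucas's conjecture asserts: if $M_1$ covers $M_2$ in the weak-map order among matroids of rank $r$ on $E$ and $\dim B(M_2)<\dim B(M_1)$, then $B(M_2)$ is a facet of $B(M_1)$. *)

theory Defs
  imports "HOL-Analysis.Analysis"
begin

text \<open>
  The ground set of a matroid is a finite type \<open>'e\<close>, and a matroid on \<open>'e\<close> is represented by
  its set of bases. Finiteness of the bases is therefore automatic.
\<close>

definition is_matroid :: "'e::finite set set \<Rightarrow> bool" where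
  "is_matroid \<B> \<longleftrightarrow>
     \<B> \<noteq> {} \<and>
     (\<forall>X\<in>\<B>. \<forall>Y\<in>\<B>. \<forall>x\<in>X - Y. \<exists>y\<in>Y - X. insert y (X - {x}) \<in> \<B>)"

definition is_matroid_of_rank :: "nat \<Rightarrow> 'e::finite set set \<Rightarrow> bool" where
  "is_matroid_of_rank r \<B> \<longleftrightarrow> is_matroid \<B> \<and> (\<forall>X\<in>\<B>. card X = r)"

definition weak_map_ge :: "'e::finite set set \<Rightarrow> 'e set set \<Rightarrow> bool" where
  "weak_map_ge N N' \<longleftrightarrow> N' \<subseteq> N"

definition weak_map_covers :: "nat \<Rightarrow> 'e::finite set set \<Rightarrow> 'e set set \<Rightarrow> bool" where
  "weak_map_covers r N N' \<longleftrightarrow>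
     is_matroid_of_rank r N \<and> is_matroid_of_rank r N' \<and>
     weak_map_ge N N' \<and> N \<noteq> N' \<and>
     (\<forall>P. is_matroid_of_rank r P \<and> weak_map_ge N P \<and> weak_map_ge P N' \<longrightarrow> P = N \<or> P = N')"

definition indicator_vec :: "'e::finite set \<Rightarrow> real ^ 'e" where
  "indicator_vec X = (\<chi> x. if x \<in> X then 1 else 0)"

definition base_polytope :: "'e::finite set set \<Rightarrow> (real ^ 'e) set" where
  "base_polytope \<B> = convex hull (indicator_vec ` \<B>)"

text \<open>
  The eleven-element ground set; the prefix \<open>E\<close> keeps single letters available as variables.
\<close>

datatype elt = Ea | Eb | Ec | Ed | Ee | Ef | Eg | Eh | Ei | Ej | Ek

lemma UNIV_elt: "(UNIV :: elt set) = {Ea, Eb, Ec, Ed, Ee, Ef, Eg, Eh, Ei, Ej, Ek}"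
proof -
  have "x \<in> {Ea, Eb, Ec, Ed, Ee, Ef, Eg, Eh, Ei, Ej, Ek}" for x :: elt
    by (cases x) simp_all
  then show ?thesis by blast
qed

instance elt :: finite
  by standard (simp add: UNIV_elt)

definition M1_lines :: "elt set set" where
  "M1_lines =
     {{Ea, Eb, Ek}, {Eb, Ec, Ee}, {Ec, Ed, Ei}, {Ea, Ed, Ef}, {Eb, Ed, Eh},
      {Ea, Ec, Ej}, {Ee, Ef, Ei}, {Ef, Eg, Ec}, {Eg, Eh, Ej}, {Eh, Ee, Ea},
      {Ee, Eg, Ed}, {Ef, Eh, Ek}, {Ei, Ej, Eb}, {Ej, Ek, Ee}, {Ek, Ei, Eg}}"

definition M1 :: "elt set set" where
  "M1 = {X. card X = 3 \<and> (\<forall>F\<in>M1_lines. card (X \<inter> F) \<le> 2)}"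

definition M2 :: "elt set set" where
  "M2 = {X. card X = 3 \<and>
            card (X \<inter> {Ea, Eb, Ec, Ed}) \<le> 1 \<and>
            card (X \<inter> {Ee, Ef, Eg, Eh}) \<le> 1 \<and>
            card (X \<inter> {Ee, Ef, Eg, Eh, Ei, Ej, Ek}) \<le> 2 \<and>
            card (X \<inter> {Ei, Ej}) \<le> 1}"

end

theory Submission
  imports Defs
begin

text \<open>
  Call a triple open if it is a basis of \<open>M1\<close> but not of \<open>M2\<close>; let \<open>N\<close> be a matroid with
  \<open>M2 \<subseteq> N \<subseteq> M1\<close>. If \<open>{p,q,x}\<close> and \<open>{p,q,y}\<close> are not bases of \<open>N\<close>, then one of
  \<open>{p,x,y}\<close> and \<open>{p,q,w}\<close> is not a basis either. Starting from the fifteen lines of \<open>M1\<close> and the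
  bases of \<open>M2\<close>, unit propagation with this clause shows that if \<open>{c,d,k}\<close> is not a basis of \<open>N\<close>
  then no open triple is, and if it is a basis then all of them are. Hence \<open>N\<close> is \<open>M2\<close> or \<open>M1\<close>.

  The polytope of \<open>M2\<close> lies in the hyperplane \<open>x\<^sub>a + x\<^sub>b + x\<^sub>c + x\<^sub>d = 1\<close>, which contains neither
  \<open>{a,b,e}\<close> nor \<open>{f,i,k}\<close>. These are bases of \<open>M1\<close> whose vertices have the same midpoint
  as those of the bases \<open>{a,e,i}\<close> and \<open>{b,f,k}\<close> of \<open>M2\<close>, so the polytope of \<open>M2\<close> is not even a face.
\<close>

section \<open>The two matroids\<close>

text \<open>Distinct lines share at most one point, so the two points of \<open>X - {x}\<close> lie
  on at most one line. If every exchange failed, each point of \<open>Y - X\<close> would lie on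
  that line, and then so would all of \<open>Y\<close>.\<close>

lemma matroid_of_lines:
  fixes L :: "'e::finite set set"
  assumes ne: "{X. card X = 3 \<and> (\<forall>F\<in>L. card (X \<inter> F) \<le> 2)} \<noteq> {}"
    and lin: "\<And>F G. F \<in> L \<Longrightarrow> G \<in> L \<Longrightarrow> F \<noteq> G \<Longrightarrow> card (F \<inter> G) \<le> 1"
  shows "is_matroid {X. card X = 3 \<and> (\<forall>F\<in>L. card (X \<inter> F) \<le> 2)}" (is "is_matroid ?B")
  unfolding is_matroid_def
proof (intro conjI ballI ne)
  fix X Y x assume X: "X \<in> ?B" and Y: "Y \<in> ?B" and x: "x \<in> X - Y"
  have cX: "card (X - {x}) = 2" using X x by simp
  show "\<exists>y\<in>Y - X. insert y (X - {x}) \<in> ?B"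
  proof (rule ccontr)
    assume no: "\<not> ?thesis"
    have line: "\<exists>F\<in>L. insert y (X - {x}) \<subseteq> F" if y: "y \<in> Y - X" for y
    proof -
      have c: "card (insert y (X - {x})) = 3" using cX y by simp
      then obtain F where F: "F \<in> L" "\<not> card (insert y (X - {x}) \<inter> F) \<le> 2"
        using no y by blast
      have "insert y (X - {x}) \<inter> F = insert y (X - {x})"
        by (rule card_seteq) (use F c in auto)
      then show ?thesis using F by blast
    qed
    have "card X = card Y" using X Y by simp
    then have "Y - X \<noteq> {}"
      using x card_subset_eq[of X Y] by auto
    then obtain y F where y: "y \<in> Y - X" and F: "F \<in> L" "insert y (X - {x}) \<subseteq> F"
      using line by blast
    have "z \<in> F" if z: "z \<in> Y - X" for z
    proof -
      obtain G where G: "G \<in> L" "insert z (X - {x}) \<subseteq> G" using line z by blast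
      have "card (X - {x}) \<le> card (F \<inter> G)"
        by (rule card_mono) (use F G in auto)
      then have "F = G" using lin F G cX by fastforce
      then show ?thesis using G by simp
    qed
    then have "Y \<subseteq> F" using F x by auto
    then have "card (Y \<inter> F) = 3" using Y by (simp add: Int_absorb2)
    then show False using Y F by fastforce
  qed
qed

lemma M1_matroid: "is_matroid_of_rank 3 M1"
proof -
  have "{Ea, Eb, Ec} \<in> M1" by (simp add: M1_def M1_lines_def Int_insert_left)
  moreover have "\<forall>F\<in>M1_lines. \<forall>G\<in>M1_lines. F = G \<or> card (F \<inter> G) \<le> 1"
    by (simp add: M1_lines_def Int_insert_left)
  ultimately have "is_matroid M1"
    using matroid_of_lines[of M1_lines] unfolding M1_def by blast
  then show ?thesis by (simp add: is_matroid_of_rank_def M1_def)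
qed

text \<open>\<open>M2\<close> is the direct sum of a rank-one matroid on \<open>{a,b,c,d}\<close>
  and a rank-two matroid with parallel classes \<open>{e,f,g,h}\<close>, \<open>{i,j}\<close>,
  \<open>{k}\<close>. The numbers label these parallel classes, 0 being the rank-one
  summand.\<close>

fun M2_class :: "elt \<Rightarrow> nat" where
  "M2_class Ea = 0" | "M2_class Eb = 0" | "M2_class Ec = 0" | "M2_class Ed = 0"
| "M2_class Ee = 1" | "M2_class Ef = 1" | "M2_class Eg = 1" | "M2_class Eh = 1"
| "M2_class Ei = 2" | "M2_class Ej = 2" | "M2_class Ek = 3"

lemma M2_class_sets:
  "{x. M2_class x = 0} = {Ea, Eb, Ec, Ed}" "{x. M2_class x = 1} = {Ee, Ef, Eg, Eh}"
  "{x. M2_class x = 2} = {Ei, Ej}" "{x. M2_class x = 3} = {Ek}"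
  "{x. M2_class x \<noteq> 0} = {Ee, Ef, Eg, Eh, Ei, Ej, Ek}"
proof -
  have "M2_class x = 0 \<longleftrightarrow> x \<in> {Ea, Eb, Ec, Ed}" "M2_class x = 1 \<longleftrightarrow> x \<in> {Ee, Ef, Eg, Eh}"
    "M2_class x = 2 \<longleftrightarrow> x \<in> {Ei, Ej}" "M2_class x = 3 \<longleftrightarrow> x \<in> {Ek}" for x
    by (cases x; simp)+
  then show "{x. M2_class x = 0} = {Ea, Eb, Ec, Ed}" "{x. M2_class x = 1} = {Ee, Ef, Eg, Eh}"
    "{x. M2_class x = 2} = {Ei, Ej}" "{x. M2_class x = 3} = {Ek}"
    by (simp_all add: set_eq_iff del: One_nat_def)
  have "M2_class x \<noteq> 0 \<longleftrightarrow> x \<in> {Ee, Ef, Eg, Eh, Ei, Ej, Ek}" for x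
    by (cases x; simp)
  then show "{x. M2_class x \<noteq> 0} = {Ee, Ef, Eg, Eh, Ei, Ej, Ek}" by blast
qed

text \<open>For a triple, having at most two points outside class 0 means meeting class 0; the other
  bounds say that no class is hit twice.\<close>

lemma M2_iff: "X \<in> M2 \<longleftrightarrow> card X = 3 \<and> inj_on M2_class X \<and> 0 \<in> M2_class ` X"
proof
  assume X: "X \<in> M2"
  have le: "card (X \<inter> {x. M2_class x = n}) \<le> 1" for n
  proof -
    have "M2_class x \<in> {0, 1, 2, 3}" for x by (cases x) auto
    then have "n \<in> {0, 1, 2, 3}" if "M2_class x = n" for x using that by metis
    then consider "{x. M2_class x = n} = {}" | "n \<in> {0, 1, 2, 3}" by (auto simp del: insert_iff)
    moreover have "card (X \<inter> {Ek}) \<le> 1" by (simp add: Int_insert_right)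
    ultimately show ?thesis
      using X by cases (auto simp: M2_def M2_class_sets simp del: One_nat_def)
  qed
  have "inj_on M2_class X"
    using le by (auto simp: inj_on_def card_le_Suc0_iff_eq)
  moreover have "0 \<in> M2_class ` X"
  proof (rule ccontr)
    assume "0 \<notin> M2_class ` X"
    then have "X \<inter> {x. M2_class x \<noteq> 0} = X" by (force simp: image_iff)
    then have "card (X \<inter> {Ee, Ef, Eg, Eh, Ei, Ej, Ek}) = card X"
      unfolding M2_class_sets by (rule arg_cong)
    then show False using X by (auto simp: M2_def)
  qed
  ultimately show "card X = 3 \<and> inj_on M2_class X \<and> 0 \<in> M2_class ` X"
    using X by (simp add: M2_def)
next
  assume X: "card X = 3 \<and> inj_on M2_class X \<and> 0 \<in> M2_class ` X"
  then have le: "card (X \<inter> {x. M2_class x = n}) \<le> 1" for n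
    by (auto simp: inj_on_def card_le_Suc0_iff_eq)
  from X obtain z where z: "z \<in> X" "M2_class z = 0" by force
  have "card (X \<inter> {x. M2_class x \<noteq> 0}) \<le> card (X - {z})"
    by (rule card_mono) (use z in auto)
  also have "\<dots> = 2" using X z by simp
  finally have "card (X \<inter> {Ee, Ef, Eg, Eh, Ei, Ej, Ek}) \<le> 2"
    unfolding M2_class_sets .
  then show "X \<in> M2"
    using X le[of 0, unfolded M2_class_sets] le[of 1, unfolded M2_class_sets]
      le[of 2, unfolded M2_class_sets]
    by (simp add: M2_def)
qed

lemma M2_triple:
  "{p, q, r} \<in> M2 \<longleftrightarrow>
     distinct [M2_class p, M2_class q, M2_class r] \<and> 0 \<in> set [M2_class p, M2_class q, M2_class r]"
proof
  assume *: "{p, q, r} \<in> M2"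
  then have "distinct [p, q, r]" by (auto simp: M2_iff card_insert_if split: if_splits)
  with * show "distinct [M2_class p, M2_class q, M2_class r] \<and>
      0 \<in> set [M2_class p, M2_class q, M2_class r]"
    by (auto simp: M2_iff inj_on_def)
next
  assume *: "distinct [M2_class p, M2_class q, M2_class r] \<and>
      0 \<in> set [M2_class p, M2_class q, M2_class r]"
  then have "distinct [p, q, r]" by auto
  with * show "{p, q, r} \<in> M2" by (auto simp: M2_iff inj_on_def)
qed

lemma M2_matroid: "is_matroid_of_rank 3 M2"
proof -
  have "is_matroid M2"
    unfolding is_matroid_def
  proof (intro conjI ballI)
    have "{Ea, Ee, Ei} \<in> M2" by (simp add: M2_triple)
    then show "M2 \<noteq> {}" by blast
  next
    fix X Y x assume X: "X \<in> M2" and Y: "Y \<in> M2" and x: "x \<in> X - Y"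
    have "card (M2_class ` (X - {x})) = 2" "card (M2_class ` Y) = 3"
      using X Y x by (simp_all add: M2_iff card_image inj_on_diff)
    \<comment> \<open>\<open>Y\<close> hits three classes and the rest of \<open>X\<close> only two,
      so \<open>Y\<close> has a point of a new class.\<close>
    then have "\<not> M2_class ` Y \<subseteq> M2_class ` (X - {x})"
      using card_mono[of "M2_class ` (X - {x})" "M2_class ` Y"] by auto
    then obtain v where v: "v \<in> Y" "M2_class v \<notin> M2_class ` (X - {x})" by blast
    obtain u where u: "u \<in> Y" "M2_class u = 0" using Y by (force simp: M2_iff)
    \<comment> \<open>If \<open>x\<close> was the class 0 point, its replacement must have class 0
      too; otherwise class 0 survives and any new class will do.\<close>
    define y where "y = (if M2_class x = 0 then u else v)"
    have "M2_class x \<notin> M2_class ` (X - {x})"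
      using X x by (auto simp: M2_iff inj_on_def)
    then have y: "y \<in> Y" "M2_class y \<notin> M2_class ` (X - {x})"
      using u v by (metis y_def)+
    then have yX: "y \<notin> X - {x}" by blast
    moreover have "y \<noteq> x" using y x by blast
    moreover have "0 \<in> M2_class ` insert y (X - {x})"
      using X u by (auto simp: M2_iff y_def)
    ultimately have "insert y (X - {x}) \<in> M2"
      using X x y by (simp add: M2_iff inj_on_diff)
    then show "\<exists>y\<in>Y - X. insert y (X - {x}) \<in> M2" using y yX \<open>y \<noteq> x\<close> by blast
  qed
  then show ?thesis by (simp add: is_matroid_of_rank_def M2_def)
qed

section \<open>Unit propagation of bases and nonbases\<close>

fun sublists_of_size :: "nat \<Rightarrow> 'a list \<Rightarrow> 'a list list" where
  "sublists_of_size 0 xs = [[]]"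
| "sublists_of_size (Suc n) [] = []"
| "sublists_of_size (Suc n) (x # xs) = map ((#) x) (sublists_of_size n xs) @ sublists_of_size (Suc n) xs"

lemma sublists_of_size_complete:
  "X \<subseteq> set xs \<Longrightarrow> card X = n \<Longrightarrow> \<exists>ys\<in>set (sublists_of_size n xs). set ys = X"
proof (induction n xs arbitrary: X rule: sublists_of_size.induct)
  case (1 xs)
  then have "finite X" by (meson List.finite_set finite_subset)
  with 1 show ?case by simp
next
  case (2 n)
  then show ?case by simp
next
  case (3 n x xs)
  show ?case
  proof (cases "x \<in> X")
    case True
    then have "X - {x} \<subseteq> set xs" "card (X - {x}) = n" using "3.prems" by auto
    then obtain ys where "ys \<in> set (sublists_of_size n xs)" "set ys = X - {x}"
      using "3.IH"(1) by blast
    then show ?thesis using True by (intro bexI[of _ "x # ys"]) auto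
  next
    case False
    then have "X \<subseteq> set xs" using "3.prems" by auto
    then show ?thesis using "3.IH"(2)[of X] "3.prems" by auto
  qed
qed

text \<open>If \<open>{p,q,w}\<close> is a basis, then \<open>x\<close> and \<open>y\<close> both
  lie on the line through \<open>p\<close> and \<open>q\<close>, so \<open>{p,x,y}\<close> cannot be
  a basis: exchanging \<open>w\<close> against it would make \<open>{p,q,x}\<close> or
  \<open>{p,q,y}\<close> one.\<close>

lemma exchange_clause:
  assumes "is_matroid N" and rank: "\<And>X. X \<in> N \<Longrightarrow> card X = 3"
    and "{p, q, x} \<notin> N" "{p, q, y} \<notin> N" "{p, x, y} \<in> N"
  shows "{p, q, w} \<notin> N"
proof
  assume w: "{p, q, w} \<in> N"
  have "distinct [p, q, w]" using rank[OF w] by (auto simp: card_insert_if split: if_splits)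
  moreover have "w \<noteq> x" "w \<noteq> y" using w assms by auto
  ultimately have "w \<in> {p, q, w} - {p, x, y}" by auto
  then obtain z where "z \<in> {p, x, y} - {p, q, w}" "insert z ({p, q, w} - {w}) \<in> N"
    using assms(1) w \<open>{p, x, y} \<in> N\<close> unfolding is_matroid_def by blast
  moreover have "insert z ({p, q, w} - {w}) = {p, q, z}"
    using \<open>distinct [p, q, w]\<close> by auto
  ultimately show False using assms by auto
qed

text \<open>Triples are kept as sorted lists, so that comparing them is cheap for the simplifier.\<close>

definition elts :: "elt list" where
  "elts = [Ea, Eb, Ec, Ed, Ee, Ef, Eg, Eh, Ei, Ej, Ek]"

definition triple :: "elt \<Rightarrow> elt \<Rightarrow> elt \<Rightarrow> elt list" where
  "triple p q r = filter (\<lambda>e. e = p \<or> e = q \<or> e = r) elts"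

lemma set_elts: "set elts = UNIV"
  by (simp add: elts_def UNIV_elt)

lemma set_triple [simp]: "set (triple p q r) = {p, q, r}"
  by (auto simp: triple_def set_elts)

definition lines :: "elt list list" where
  "lines =
     [[Ea, Eb, Ek], [Eb, Ec, Ee], [Ec, Ed, Ei], [Ea, Ed, Ef], [Eb, Ed, Eh],
      [Ea, Ec, Ej], [Ee, Ef, Ei], [Ec, Ef, Eg], [Eg, Eh, Ej], [Ea, Ee, Eh],
      [Ed, Ee, Eg], [Ef, Eh, Ek], [Eb, Ei, Ej], [Ee, Ej, Ek], [Eg, Ei, Ek]]"

lemma lines_M1_lines: "set ` set lines = M1_lines"
  by (simp add: lines_def M1_lines_def insert_commute)

fun M2_test :: "elt list \<Rightarrow> bool" where
  "M2_test [p, q, r] \<longleftrightarrow>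
     distinct [M2_class p, M2_class q, M2_class r] \<and> 0 \<in> set [M2_class p, M2_class q, M2_class r]"
| "M2_test _ \<longleftrightarrow> False"

lemma M2_test_set: "M2_test t \<Longrightarrow> set t \<in> M2"
  by (cases t rule: M2_test.cases) (auto simp: M2_triple)

type_synonym row = "elt \<times> elt \<times> elt \<times> elt \<times> elt"

text \<open>
  A row \<open>(p, q, x, y, w)\<close> stands for an instance of \<open>exchange_clause\<close> in which \<open>{p,q,y}\<close>
  is a line of \<open>M1\<close>. The tables of rows were found by a computer search and are listed in the order
  in which unit propagation uses them.
\<close>

fun add_nonbasis :: "row \<Rightarrow> elt list list \<Rightarrow> elt list list" where
  "add_nonbasis (p, q, x, y, w) D =
     (if triple p q y \<in> set lines \<and> triple p q x \<in> set D then
        if M2_test (triple p x y) then triple p q w # D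
        else if M2_test (triple p q w) then triple p x y # D
        else D
      else D)"

text \<open>The same clause read backwards: with \<open>{p,q,y}\<close> a line, bases
  \<open>{p,x,y}\<close> and \<open>{p,q,w}\<close> force \<open>{p,q,x}\<close> to be a
  basis.\<close>

fun add_basis :: "row \<Rightarrow> elt list list \<Rightarrow> elt list list" where
  "add_basis (p, q, x, y, w) B =
     (if triple p q y \<in> set lines
         \<and> (M2_test (triple p x y) \<or> triple p x y \<in> set B)
         \<and> (M2_test (triple p q w) \<or> triple p q w \<in> set B)
      then triple p q x # B else B)"

section \<open>Soundness of propagation inside a matroid between \<open>M2\<close> and
  \<open>M1\<close>\<close>

context
  fixes N :: "elt set set"
  assumes N: "is_matroid N" "M2 \<subseteq> N" "N \<subseteq> M1"
begin

lemma card_between: "X \<in> N \<Longrightarrow> card X = 3"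
  using N by (auto simp: M1_def)

lemma line_nonbasis:
  assumes "l \<in> set lines"
  shows "set l \<notin> N"
proof
  assume "set l \<in> N"
  moreover have "set l \<in> M1_lines" using assms lines_M1_lines by blast
  ultimately have "card (set l \<inter> set l) \<le> 2" "card (set l) = 3"
    using N(3) unfolding M1_def by blast+
  then show False by simp
qed

lemma M2_test_basis: "M2_test t \<Longrightarrow> set t \<in> N"
  using M2_test_set N by blast

text \<open>Nothing is assumed of the row: one whose premises fail the test leaves the list
  unchanged, so the tables need not be trusted.\<close>

lemma add_nonbasis_sound:
  assumes "\<forall>t\<in>set D. set t \<notin> N"
  shows "\<forall>t\<in>set (add_nonbasis r D). set t \<notin> N"
proof -
  obtain p q x y w where r: "r = (p, q, x, y, w)" by (cases r)
  \<comment> \<open>The clause yields only a disjunction; a basis of \<open>M2\<close> among the two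
    triples decides which one is the nonbasis.\<close>
  have *: "set (triple p x y) \<notin> N \<or> set (triple p q w) \<notin> N"
    if "triple p q y \<in> set lines" "triple p q x \<in> set D"
    using that assms line_nonbasis[of "triple p q y"] exchange_clause[OF N(1) card_between, of p q x y w]
    by fastforce
  show ?thesis
    using assms * M2_test_basis[of "triple p x y"] M2_test_basis[of "triple p q w"]
    by (auto simp: r simp del: set_triple)
qed

lemma add_basis_sound:
  assumes "\<forall>t\<in>set B. set t \<in> N"
  shows "\<forall>t\<in>set (add_basis r B). set t \<in> N"
proof -
  obtain p q x y w where r: "r = (p, q, x, y, w)" by (cases r)
  have *: "set (triple p q x) \<in> N"
    if "triple p q y \<in> set lines" "set (triple p x y) \<in> N" "set (triple p q w) \<in> N"
    using that line_nonbasis[of "triple p q y"] exchange_clause[OF N(1) card_between, of p q x y w]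
    by fastforce
  show ?thesis
    using assms * M2_test_basis[of "triple p x y"] M2_test_basis[of "triple p q w"]
    by (auto simp: r simp del: set_triple split: if_splits)
qed

lemma fold_add_nonbasis:
  "\<forall>t\<in>set D. set t \<notin> N \<Longrightarrow> \<forall>t\<in>set (fold add_nonbasis rs D). set t \<notin> N"
proof (induction rs arbitrary: D)
  case (Cons r rs)
  then show ?case using add_nonbasis_sound[OF Cons.prems, of r] by simp
qed simp

lemma fold_add_basis:
  "\<forall>t\<in>set B. set t \<in> N \<Longrightarrow> \<forall>t\<in>set (fold add_basis rs B). set t \<in> N"
proof (induction rs arbitrary: B)
  case (Cons r rs)
  then show ?case using add_basis_sound[OF Cons.prems, of r] by simp
qed simp

end

section \<open>The interval between \<open>M2\<close> and \<open>M1\<close>\<close>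

definition nonbasis_rows :: "row list" where
  "nonbasis_rows =
    [(Ec,Ed,Ek,Ei,Ea), (Ec,Ed,Ek,Ei,Eb), (Ec,Ed,Ek,Ei,Ee), (Ec,Ed,Ee,Ei,Ef),
     (Ec,Ed,Ef,Ei,Eg), (Ec,Ed,Eg,Ei,Eh), (Ec,Ed,Eh,Ei,Ej), (Ej,Ec,Ed,Ea,Ee),
     (Ea,Ed,Ej,Ef,Eb), (Ea,Ed,Ej,Ef,Ee), (Ea,Ee,Ed,Eh,Ei), (Eh,Ea,Ed,Ee,Ei),
     (Ed,Ee,Eh,Eg,Ei), (Ed,Eh,Eg,Eb,Ei), (Ed,Eg,Eb,Ee,Ei), (Ee,Ed,Eb,Eg,Ei),
     (Eb,Ee,Eg,Ec,Ei), (Ec,Eg,Eb,Ef,Ei), (Ef,Ec,Eb,Eg,Ei), (Ee,Eb,Eg,Ec,Ei),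
     (Ec,Eg,Ee,Ef,Ei), (Ee,Ec,Ef,Eb,Ei), (Ee,Ef,Eb,Ei,Ea), (Ea,Ee,Ef,Eh,Ei),
     (Ef,Ea,Eh,Ed,Ei), (Ed,Eh,Ef,Eb,Ei), (Ef,Ed,Eb,Ea,Ei), (Ea,Eb,Ef,Ek,Ec),
     (Ea,Eb,Ef,Ek,Ee), (Ea,Eb,Ee,Ek,Eg), (Ea,Eb,Eg,Ek,Eh), (Ea,Eb,Eh,Ek,Ei),
     (Ea,Eb,Ei,Ek,Ej), (Ej,Ea,Eb,Ec,Ee), (Eb,Ec,Ej,Ee,Eh), (Eb,Ec,Ej,Ee,Ei),
     (Eb,Ec,Ei,Ee,Ek), (Ek,Eb,Ec,Ea,Ee), (Ea,Ec,Ek,Ej,Ee), (Ea,Ec,Ee,Ej,Ef),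
     (Ea,Ec,Ef,Ej,Eg), (Ea,Ec,Eg,Ej,Eh), (Ea,Ec,Eh,Ej,Ei), (Ei,Ec,Ea,Ed,Ee),
     (Ea,Ed,Ei,Ef,Eg), (Eg,Ed,Ea,Ee,Ei), (Ea,Ee,Eg,Eh,Ei), (Eg,Eh,Ea,Ej,Eb),
     (Eg,Eh,Eb,Ej,Ec), (Ec,Eg,Eh,Ef,Ei), (Ef,Ec,Eh,Eg,Ei), (Ef,Eh,Ec,Ek,Eb),
     (Ef,Eh,Eb,Ek,Ee), (Ef,Eh,Eb,Ek,Ei), (Ei,Ef,Eh,Ee,Ea), (Ee,Eh,Ei,Ea,Eb),
     (Ee,Eb,Eh,Ec,Ei), (Ee,Eh,Ei,Ea,Eg), (Ee,Eh,Ei,Ea,Ej), (Ee,Eh,Ej,Ea,Ek),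
     (Ek,Ee,Eh,Ej,Ea), (Eh,Ej,Ek,Eg,Ea), (Eg,Ek,Eh,Ei,Ea), (Ei,Eg,Eh,Ek,Ea),
     (Ek,Eh,Ei,Ef,Ea), (Ef,Ei,Ek,Ee,Ea), (Ee,Ek,Ef,Ej,Ea), (Ej,Ee,Ef,Ek,Ea),
     (Ef,Ek,Ej,Eh,Ea), (Ej,Eh,Ef,Eg,Ea), (Ef,Eg,Ej,Ec,Ea), (Ef,Ea,Eg,Ed,Ei),
     (Ed,Eg,Ef,Ee,Ei), (Ee,Ed,Ef,Eg,Ei), (Ef,Eg,Ej,Ec,Ei), (Ef,Eg,Ei,Ec,Ek),
     (Ei,Ef,Eg,Ee,Ea), (Ee,Eg,Ei,Ed,Ej), (Ee,Eg,Ej,Ed,Ek), (Ek,Ee,Eg,Ej,Ea),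
     (Eg,Ek,Ej,Ei,Ea), (Ei,Eg,Ej,Ek,Ea), (Ei,Ej,Ek,Eb,Ea), (Ej,Ea,Ei,Ec,Ee),
     (Ei,Ec,Ej,Ed,Ee), (Ei,Ej,Ek,Eb,Ee), (Ee,Ej,Ei,Ek,Ea), (Ei,Ee,Ej,Ef,Ea),
     (Ei,Ej,Ef,Eb,Eh), (Ea,Ed,Ei,Ef,Ek), (Ek,Ea,Ed,Eb,Ee), (Eb,Ed,Ek,Eh,Ei),
     (Eb,Ed,Ei,Eh,Ej)]"

text \<open>For instance, the first row uses the line \<open>{c,d,i}\<close>, the basis
  \<open>{c,e,i}\<close> of \<open>M2\<close> and the seed \<open>{c,d,k}\<close> to obtain the
  basis \<open>{c,d,e}\<close>.\<close>

definition basis_rows :: "row list" where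
  "basis_rows =
    [(Ec,Ed,Ee,Ei,Ek), (Ec,Ed,Ef,Ei,Ee), (Ec,Ed,Eg,Ei,Ef), (Ec,Ed,Eh,Ei,Eg),
     (Eh,Eb,Ec,Ed,Ei), (Eb,Ec,Ei,Ee,Eh), (Eb,Ec,Ej,Ee,Ei), (Eb,Ec,Ek,Ee,Ej),
     (Ek,Ea,Ec,Eb,Ee), (Ea,Ec,Ee,Ej,Ek), (Ea,Ec,Ef,Ej,Ee), (Ea,Ec,Eg,Ej,Ef),
     (Ea,Ec,Eh,Ej,Eg), (Ee,Eb,Ea,Ec,Ei), (Ea,Eb,Ef,Ek,Ee), (Ea,Eb,Eg,Ek,Ef),
     (Ea,Eb,Eh,Ek,Eg), (Ea,Eb,Ei,Ek,Eh), (Ea,Eb,Ej,Ek,Ei), (Eh,Ed,Ea,Eb,Ei),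
     (Ea,Ed,Ei,Ef,Eh), (Ea,Ed,Ej,Ef,Ei), (Ea,Ed,Ek,Ef,Ej), (Ek,Eb,Ed,Ea,Ee),
     (Eb,Ed,Ei,Eh,Ek), (Eb,Ed,Ej,Eh,Ei), (Ej,Ec,Ed,Ea,Ee), (Ec,Ei,Ej,Ed,Ee),
     (Ei,Ed,Ej,Ec,Ee), (Ei,Ej,Ee,Eb,Ed), (Ee,Ek,Ei,Ej,Ea), (Ei,Ef,Ek,Ee,Ea),
     (Ei,Eg,Ef,Ek,Ea), (Ef,Eg,Ej,Ec,Ei), (Ef,Eg,Ek,Ec,Ej), (Ek,Eh,Eg,Ef,Ea),
     (Eg,Eh,Ea,Ej,Ek), (Ea,Ee,Eg,Eh,Ei), (Ee,Ed,Ea,Eg,Ei), (Ea,Ef,Ee,Ed,Ei),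
     (Ea,Eh,Ef,Ee,Ei), (Ef,Ed,Eh,Ea,Ei), (Ef,Eh,Eb,Ek,Ed), (Ef,Eh,Ec,Ek,Eb),
     (Ec,Eg,Eh,Ef,Ei), (Eg,Eh,Eb,Ej,Ec), (Eg,Eh,Ed,Ej,Eb), (Ed,Ee,Eh,Eg,Ei),
     (Ee,Eh,Ei,Ea,Ed), (Ee,Eh,Ej,Ea,Ei), (Ee,Eh,Ek,Ea,Ej), (Ek,Ef,Ee,Eh,Ea),
     (Ee,Ef,Eb,Ei,Ek), (Ee,Ec,Ef,Eb,Ei), (Ec,Eg,Ee,Ef,Ei), (Ee,Eb,Eg,Ec,Ei),
     (Ee,Ed,Eb,Eg,Ei), (Eb,Eh,Ee,Ed,Ei), (Ee,Ec,Eh,Eb,Ei), (Ed,Eg,Eb,Ee,Ei),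
     (Ee,Eg,Ei,Ed,Eb), (Ee,Eg,Ej,Ed,Ei), (Ee,Eg,Ek,Ed,Ej), (Ek,Ej,Eg,Ee,Ea),
     (Eg,Ei,Ej,Ek,Ea), (Ei,Ej,Ef,Eb,Eg), (Ei,Ej,Eh,Eb,Ef), (Ei,Ej,Ek,Eb,Eh),
     (Ej,Eh,Ek,Eg,Ea), (Ek,Ef,Ej,Eh,Ea), (Ej,Ee,Ef,Ek,Ea), (Ee,Ef,Ed,Ei,Ej),
     (Ed,Eg,Ef,Ee,Ei), (Ef,Ea,Eg,Ed,Ei), (Eg,Ee,Ef,Ed,Ek), (Ei,Ef,Eh,Ee,Ea),
     (Eh,Ek,Ei,Ef,Ea), (Ei,Eg,Eh,Ek,Ea), (Ef,Ee,Eh,Ei,Eg), (Ef,Eh,Ej,Ek,Ee),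
     (Eh,Eg,Ef,Ej,Ei), (Eg,Eh,Ee,Ej,Ef), (Ed,Eg,Ea,Ee,Ei), (Ej,Ea,Ei,Ec,Ee),
     (Ei,Ec,Ea,Ed,Ee), (Ec,Ea,Ed,Ej,Ei), (Ed,Ec,Eb,Ei,Ea), (Eb,Ec,Eg,Ee,Ed),
     (Ec,Ef,Eb,Eg,Ei), (Ef,Eg,Eb,Ec,Eh), (Eb,Ed,Ef,Eh,Ec), (Ed,Ea,Eb,Ef,Ec),
     (Ea,Ec,Eb,Ej,Ed)]"

text \<open>Propagation has reached every open triple. Of the 165 triples, 56 are bases of
  \<open>M2\<close> and 15 are lines, which leaves 94: the seed \<open>{c,d,k}\<close> and one for
  each of the 93 rows of a table.\<close>

definition settles :: "elt list list \<Rightarrow> bool" where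
  "settles D \<longleftrightarrow>
     list_all (\<lambda>t. M2_test t \<or> t \<in> set lines \<or> t \<in> set D)
       (sublists_of_size 3 elts)"

lemma settlesE:
  assumes "settles D" "X \<in> M1" "X \<notin> M2"
  shows "\<exists>t\<in>set D. set t = X"
proof -
  have "card X = 3" using assms by (simp add: M1_def)
  then obtain t where t: "t \<in> set (sublists_of_size 3 elts)" "set t = X"
    using sublists_of_size_complete[of X elts] set_elts by blast
  have "\<not> M2_test t" using M2_test_set t assms by blast
  moreover have "t \<notin> set lines"
  proof
    assume "t \<in> set lines"
    then have "X \<in> M1_lines" using t lines_M1_lines by blast
    then show False using assms(2) by (auto simp: M1_def)
  qed
  ultimately show ?thesis using assms t unfolding settles_def list_all_iff by metis
qed

lemma settles_nonbasis_rows: "settles (fold add_nonbasis nonbasis_rows [[Ec, Ed, Ek]])"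
  by code_simp

lemma settles_basis_rows: "settles (fold add_basis basis_rows [[Ec, Ed, Ek]])"
  by code_simp

text \<open>A triple that is not a basis of \<open>M1\<close> equals one of the fifteen lines, and
  each line repeats a class or misses class 0.\<close>

lemma M2_subset_M1: "M2 \<subseteq> M1"
proof
  fix X assume X: "X \<in> M2"
  have "\<not> F \<subseteq> X" if F: "F \<in> M1_lines" for F
  proof -
    have "\<forall>F\<in>M1_lines. F \<notin> M2"
      by (simp add: M1_lines_def M2_triple)
    moreover have "card F = 3" using F by (auto simp: M1_lines_def)
    ultimately show ?thesis
      using F X card_subset_eq[of X F] by (auto simp: M2_iff)
  qed
  moreover have "F \<subseteq> X" if "F \<in> M1_lines" "\<not> card (X \<inter> F) \<le> 2" for F
  proof -
    have "card F = 3" using that by (auto simp: M1_lines_def)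
    then have "X \<inter> F = F" by (intro card_seteq) (use that in auto)
    then show ?thesis by blast
  qed
  ultimately show "X \<in> M1" using X by (auto simp: M1_def M2_iff)
qed

lemma between_M2_M1:
  assumes "is_matroid N" "M2 \<subseteq> N" "N \<subseteq> M1"
  shows "N = M1 \<or> N = M2"
proof (cases "{Ec, Ed, Ek} \<in> N")
  case True
  then have "\<forall>t\<in>set (fold add_basis basis_rows [[Ec, Ed, Ek]]). set t \<in> N"
    by (intro fold_add_basis[OF assms]) simp
  then have "M1 \<subseteq> N" using settlesE[OF settles_basis_rows] assms(2) by blast
  then show ?thesis using assms by blast
next
  case False
  then have "\<forall>t\<in>set (fold add_nonbasis nonbasis_rows [[Ec, Ed, Ek]]). set t \<notin> N"
    by (intro fold_add_nonbasis[OF assms]) simp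
  then have "N \<subseteq> M2" using settlesE[OF settles_nonbasis_rows] assms(3) by blast
  then show ?thesis using assms by blast
qed

section \<open>The base polytopes\<close>

text \<open>The functional of the direct summand \<open>{a,b,c,d}\<close> of \<open>M2\<close>,
  constant on the polytope because every basis takes exactly one point from it.\<close>

definition abcd_sum :: "real ^ elt \<Rightarrow> real" where
  "abcd_sum v = v $ Ea + v $ Eb + v $ Ec + v $ Ed"

lemma affine_abcd_sum: "affine {v. abcd_sum v = 1}"
proof -
  have "abcd_sum (u *\<^sub>R x + v *\<^sub>R y) = u * abcd_sum x + v * abcd_sum y" for u v x y
    by (simp add: abcd_sum_def algebra_simps)
  then show ?thesis by (simp add: affine_def)
qed

lemma abcd_sum_M2:
  assumes "X \<in> M2"
  shows "abcd_sum (indicator_vec X) = 1"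
proof -
  obtain z where z: "z \<in> X" "M2_class z = 0" using assms by (force simp: M2_iff)
  have "x \<in> X \<longleftrightarrow> x = z" if "M2_class x = 0" for x
    using assms z that by (auto simp: M2_iff inj_on_def)
  then have "abcd_sum (indicator_vec X) =
      (if Ea = z then 1 else 0) + (if Eb = z then 1 else 0) +
      (if Ec = z then 1 else 0) + (if Ed = z then 1 else 0)"
    by (simp add: abcd_sum_def indicator_vec_def)
  then show ?thesis using z by (cases z) simp_all
qed

lemma affine_hull_base_polytope_M2: "affine hull (base_polytope M2) \<subseteq> {v. abcd_sum v = 1}"
  unfolding base_polytope_def affine_hull_convex_hull
  by (rule hull_minimal) (auto simp: abcd_sum_M2 affine_abcd_sum)

lemma indicator_vec_in_base_polytope: "X \<in> \<B> \<Longrightarrow> indicator_vec X \<in> base_polytope \<B>"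
  unfolding base_polytope_def by (simp add: hull_inc)

lemma abe_fik_M1: "{Ea, Eb, Ee} \<in> M1" "{Ef, Ei, Ek} \<in> M1"
  by (simp_all add: M1_def M1_lines_def Int_insert_left)

lemma abe_notin_affine_hull: "indicator_vec {Ea, Eb, Ee} \<notin> affine hull (base_polytope M2)"
proof -
  have "abcd_sum (indicator_vec {Ea, Eb, Ee}) = 2"
    by (simp add: abcd_sum_def indicator_vec_def)
  then show ?thesis using affine_hull_base_polytope_M2 by auto
qed

text \<open>Strictly nested affine hulls have different dimensions, and the vertex of
  \<open>{a,b,e}\<close> separates the two hulls.\<close>

lemma aff_dim_base_polytope_M2_less: "aff_dim (base_polytope M2) < aff_dim (base_polytope M1)"
proof (rule aff_dim_psubset)
  have "base_polytope M2 \<subseteq> base_polytope M1"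
    unfolding base_polytope_def using M2_subset_M1 by (intro hull_mono image_mono)
  then have "affine hull base_polytope M2 \<subseteq> affine hull base_polytope M1"
    by (rule hull_mono)
  moreover have "indicator_vec {Ea, Eb, Ee} \<in> affine hull base_polytope M1"
    by (intro hull_inc indicator_vec_in_base_polytope abe_fik_M1)
  ultimately show "affine hull base_polytope M2 \<subset> affine hull base_polytope M1"
    using abe_notin_affine_hull by blast
qed

lemma not_base_polytope_M2_face: "\<not> base_polytope M2 face_of base_polytope M1"
proof
  assume face: "base_polytope M2 face_of base_polytope M1"
  let ?u = "indicator_vec {Ea, Eb, Ee}" and ?v = "indicator_vec {Ef, Ei, Ek}"
  have "{Ea, Ee, Ei} \<in> M2" "{Eb, Ef, Ek} \<in> M2" by (simp_all add: M2_triple)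
  then have in2: "indicator_vec {Ea, Ee, Ei} \<in> base_polytope M2"
    "indicator_vec {Eb, Ef, Ek} \<in> base_polytope M2"
    by (simp_all add: indicator_vec_in_base_polytope)
  \<comment> \<open>Both pairs of triples partition \<open>{a,b,e,f,i,k}\<close>.\<close>
  have "?u + ?v = indicator_vec {Ea, Ee, Ei} + indicator_vec {Eb, Ef, Ek}"
    by (simp add: indicator_vec_def vec_eq_iff)
  then have "midpoint ?u ?v = midpoint (indicator_vec {Ea, Ee, Ei}) (indicator_vec {Eb, Ef, Ek})"
    by (simp add: midpoint_def)
  also have "\<dots> \<in> base_polytope M2"
    using in2 convexD_alt[of "base_polytope M2" _ _ "1/2"]
    by (simp add: midpoint_def base_polytope_def scaleR_add_right)
  finally have mid: "midpoint ?u ?v \<in> base_polytope M2" .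
  have "?u $ Ea \<noteq> ?v $ Ea" by (simp add: indicator_vec_def)
  then have "?u \<noteq> ?v" by metis
  \<comment> \<open>A face that contains an interior point of a segment of the polytope contains its
    endpoints as well.\<close>
  then have "midpoint ?u ?v \<in> open_segment ?u ?v" by simp
  then have "?u \<in> base_polytope M2"
    using face mid abe_fik_M1[THEN indicator_vec_in_base_polytope] unfolding face_of_def by blast
  then show False using abe_notin_affine_hull by (simp add: hull_inc)
qed

theorem theorem5p12:
  shows "is_matroid_of_rank 3 M1 \<and> is_matroid_of_rank 3 M2 \<and>
         M2 \<subseteq> M1 \<and>
         weak_map_covers 3 M1 M2 \<and>
         \<not> (\<exists>M3 :: elt set set. is_matroid M3 \<and> M2 \<subset> M3 \<and> M3 \<subset> M1) \<and>
         aff_dim (base_polytope M2) < aff_dim (base_polytope M1) \<and>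
         \<not> base_polytope M2 facet_of base_polytope M1"
proof -
  have "M1 \<noteq> M2" using aff_dim_base_polytope_M2_less by auto
  then have "weak_map_covers 3 M1 M2"
    using M1_matroid M2_matroid M2_subset_M1 between_M2_M1
    by (auto simp: weak_map_covers_def weak_map_ge_def is_matroid_of_rank_def)
  moreover have "\<not> (\<exists>M3. is_matroid M3 \<and> M2 \<subset> M3 \<and> M3 \<subset> M1)"
    using between_M2_M1 by blast
  moreover have "\<not> base_polytope M2 facet_of base_polytope M1"
    using not_base_polytope_M2_face by (auto simp: facet_of_def)
  ultimately show ?thesis
    using M1_matroid M2_matroid M2_subset_M1 aff_dim_base_polytope_M2_less by blast
qed

end
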